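(* For real $x>5$, let $S_{\mu}(x)=\sum_{mn\le x}\mu(\gcd(m,n))$, where the sum runs over all ordered pairs $(m,n)$ of positive integers with $mn\le x$. Then, for every real number $x>5$, $$S_{\mu}(x)=\frac{1}{\zeta^{2}(2)}\left(\log x+2\gamma-1-4\frac{\zeta'(2)}{\zeta(2)}\right)x+O\left(x^{1/2}\log^{2}x\right),$$ where the implied constant is absolute.
   Context: $\mu$ is the Möbius function, $\zeta$ is the Riemann zeta-function, $\zeta'$ is its first derivative, and $\gamma$ is the Euler--Mascheroni constant. *)

theory Defs
  imports
    "HOL-Analysis.Analysis"
    "HOL-Complex_Analysis.Complex_Analysis"
    "HOL-Computational_Algebra.Computational_Algebra"
begin

definition moebius :: "nat \<Rightarrow> int" where
  "moebius n = (if squarefree n then (-1) ^ card (prime_factors n) else 0)"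

text \<open>
  The Riemann zeta-function on the half-plane \<open>Re s > 1\<close>, where it is given by its Dirichlet
  series. The analytic continuation is not modelled: outside this half-plane the value carries
  no meaning. In what follows it is only evaluated and differentiated at \<open>s = 2\<close>.
\<close>

definition zeta :: "complex \<Rightarrow> complex" where
  "zeta s = (\<Sum>n. 1 / of_nat (Suc n) powr s)"

definition S_mu :: "real \<Rightarrow> int" where
  "S_mu x = (\<Sum>(m, n) \<in> {(m, n). 0 < m \<and> 0 < n \<and> real (m * n) \<le> x}. moebius (gcd m n))"

lemma zeta_sums:
  assumes "Re s > 1"
  shows "(\<lambda>n. 1 / of_nat (Suc n) powr s) sums zeta s"
proof -
  have "summable (\<lambda>n. real n powr (- Re s))"
    using assms by (simp add: summable_real_powr_iff)
  then have "summable (\<lambda>n. real (Suc n) powr (- Re s))"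
    by (subst summable_Suc_iff)
  moreover have "norm (1 / of_nat (Suc n) powr s) = real (Suc n) powr (- Re s)" for n
  proof -
    have "norm (of_nat (Suc n) powr s) = real (Suc n) powr Re s"
      using norm_powr_real_powr[of "of_nat (Suc n)" s] by (simp del: of_nat_Suc)
    then show ?thesis
      by (simp only: norm_divide norm_one powr_minus_divide)
  qed
  ultimately have "summable (\<lambda>n. norm (1 / of_nat (Suc n) powr s))"
    by (simp only:)
  then have "summable (\<lambda>n. 1 / of_nat (Suc n) powr s)"
    by (rule summable_norm_cancel)
  then show ?thesis
    unfolding zeta_def by (rule summable_sums)
qed

lemma finite_S_mu_index:
  "finite {(m, n). 0 < m \<and> 0 < n \<and> real (m * n) \<le> x}"
proof (rule finite_subset)
  show "{(m, n). 0 < m \<and> 0 < n \<and> real (m * n) \<le> x} \<subseteq> {..nat \<lfloor>x\<rfloor>} \<times> {..nat \<lfloor>x\<rfloor>}"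
  proof clarify
    fix m n :: nat
    assume mn: "0 < m" "0 < n" "real (m * n) \<le> x"
    have "m * n \<le> nat \<lfloor>x\<rfloor>"
      using mn(3) by (rule le_nat_floor)
    moreover have "m * 1 \<le> m * n" "1 * n \<le> m * n"
      using mn(1,2) by (intro mult_le_mono; simp)+
    ultimately show "m \<in> {..nat \<lfloor>x\<rfloor>} \<and> n \<in> {..nat \<lfloor>x\<rfloor>}"
      unfolding atMost_iff mult_1 mult_1_right by linarith
  qed
qed simp

end

theory Submission
  imports Defs "HOL-Real_Asymp.Real_Asymp"
begin

text \<open>
  Let \<open>D(y)\<close> count the pairs with \<open>mn \<le> y\<close> and \<open>P(y)\<close> the coprime ones among them. Moebius
  inversion gives \<open>P(y) = \<Sum>d\<le>\<surd>y. \<mu>(d) D(y/d\<^sup>2)\<close>, and grouping pairs by their gcd gives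
  \<open>S\<^sub>\<mu>(x) = \<Sum>d\<le>\<surd>x. \<mu>(d) P(x/d\<^sup>2)\<close>.
  So \<open>S\<^sub>\<mu>\<close> arises from \<open>D\<close> by applying the same transform twice.
  If \<open>F(y) = y (A log y + B) + O(\<surd>y (1 + log y)\<^sup>k)\<close>, then the transform of \<open>F\<close> has the same shape
  with \<open>A M\<close>, \<open>B M - 2 A L\<close> and \<open>k + 1\<close> in place of \<open>A\<close>, \<open>B\<close> and \<open>k\<close>, where
  \<open>M = \<Sum> \<mu>(n)/n\<^sup>2 = 1/\<zeta>(2)\<close> and \<open>L = \<Sum> \<mu>(n) log n/n\<^sup>2 = \<zeta>'(2)/\<zeta>(2)\<^sup>2\<close>. Dirichlet's hyperbola
  method provides the starting point \<open>A = 1\<close>, \<open>B = 2\<gamma> - 1\<close>, \<open>k = 0\<close> for \<open>D\<close>.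
\<close>

section \<open>The Moebius function\<close>

lemma moebius_0 [simp]: "moebius 0 = 0"
  by (simp add: moebius_def)

lemma moebius_1 [simp]: "moebius (Suc 0) = 1"
  using squarefree_1[where ?'a = nat] by (simp add: moebius_def)

lemma abs_moebius_le: "\<bar>moebius n\<bar> \<le> 1"
  by (simp add: moebius_def)

lemma moebius_prime_mult:
  assumes "prime p" "\<not> p dvd d"
  shows "moebius (p * d) = - moebius d"
proof -
  have d: "d \<noteq> 0"
    using assms(2) by (cases "d = 0") auto
  have p: "p \<noteq> 0"
    using assms(1) by auto
  have "coprime p d"
    using assms prime_imp_coprime by blast
  then have "squarefree (p * d) \<longleftrightarrow> squarefree d"
    using squarefree_mult_coprime squarefree_multD(2) squarefree_prime assms(1) by metis
  moreover have "prime_factors (p * d) = insert p (prime_factors d)"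
    using p d assms(1) by (simp add: prime_factors_product prime_prime_factors)
  moreover have "p \<notin> prime_factors d"
    using assms(2) by auto
  ultimately show ?thesis
    by (simp add: moebius_def)
qed

lemma moebius_prime_mult_dvd:
  assumes "prime p" "p dvd d"
  shows "moebius (p * d) = 0"
proof -
  have "p ^ 2 dvd p * d"
    using assms(2) by (simp add: power2_eq_square)
  then have "\<not> squarefree (p * d)"
    using not_squarefreeI[of p "p * d"] assms(1) prime_gt_1_nat[of p] by auto
  then show ?thesis
    by (simp add: moebius_def)
qed

text \<open>For a prime \<open>p\<close> dividing \<open>n\<close>, multiplication by
  \<open>p\<close> maps the divisors prime to \<open>p\<close> into those divisible by
  \<open>p\<close> and flips the sign of \<open>moebius\<close>. Members of \<open>B\<close> outside
  the image are divisible by \<open>p^2\<close> and contribute 0, so everything cancels.\<close>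

lemma sum_moebius_divisors:
  assumes "n > 0"
  shows "(\<Sum>d | d dvd n. moebius d) = (if n = 1 then 1 else 0)"
proof (cases "n = 1")
  case True
  then show ?thesis by simp
next
  case False
  then obtain p where p: "prime p" "p dvd n"
    using prime_factor_nat by blast
  define A where "A = {d. d dvd n \<and> \<not> p dvd d}"
  define B where "B = {d. d dvd n \<and> p dvd d}"
  have fin: "finite A" "finite B"
    using assms unfolding A_def B_def by (auto intro: finite_subset[of _ "{d. d dvd n}"])
  have sub: "(*) p ` A \<subseteq> B"
    using p by (auto simp: A_def B_def intro!: divides_mult prime_imp_coprime)
  have "sum moebius B = sum moebius ((*) p ` A)"
  proof (rule sum.mono_neutral_right[OF fin(2) sub], rule ballI)
    fix d assume d: "d \<in> B - (*) p ` A"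
    then obtain e where e: "d = p * e"
      by (auto simp: B_def)
    have "p dvd e"
      using d e dvd_mult_right[of p e n] by (auto simp: A_def B_def)
    then show "moebius d = 0"
      using moebius_prime_mult_dvd p(1) e by simp
  qed
  also have "\<dots> = (\<Sum>d\<in>A. moebius (p * d))"
    using p(1) by (subst sum.reindex) (auto intro!: inj_onI)
  also have "\<dots> = - sum moebius A"
    using p(1) by (simp add: A_def moebius_prime_mult sum_negf)
  finally have "sum moebius A + sum moebius B = 0" by simp
  moreover have "{d. d dvd n} = A \<union> B" "A \<inter> B = {}"
    by (auto simp: A_def B_def)
  ultimately show ?thesis
    using False fin by (simp add: sum.union_disjoint)
qed

section \<open>Counting pairs\<close>

text \<open>This is the index set of \<open>S_mu\<close>; its cardinality is the summatory function
  of the number of divisors.\<close>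

definition pairs_le :: "real \<Rightarrow> (nat \<times> nat) set" where
  "pairs_le y = {(m, n). 0 < m \<and> 0 < n \<and> real (m * n) \<le> y}"

definition coprime_pairs_le :: "real \<Rightarrow> (nat \<times> nat) set" where
  "coprime_pairs_le y = {(m, n) \<in> pairs_le y. coprime m n}"

lemma finite_pairs_le: "finite (pairs_le y)"
  unfolding pairs_le_def by (rule finite_S_mu_index)

lemma le_nat_floor_sqrt_iff: "n \<le> nat \<lfloor>sqrt y\<rfloor> \<longleftrightarrow> real n ^ 2 \<le> y" if "y \<ge> 0"
proof -
  have "n \<le> nat \<lfloor>sqrt y\<rfloor> \<longleftrightarrow> real n \<le> sqrt y"
    using that by (simp add: le_nat_iff le_floor_iff)
  also have "\<dots> \<longleftrightarrow> real n ^ 2 \<le> y"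
    using that real_le_rsqrt sqrt_ge_absD by force
  finally show ?thesis .
qed

lemma scale_mem_pairs_le_iff:
  assumes "d > 0"
  shows "(d * m, d * n) \<in> pairs_le y \<longleftrightarrow> (m, n) \<in> pairs_le (y / real d ^ 2)"
  using assms by (auto simp: pairs_le_def field_simps power2_eq_square)

text \<open>This follows from \<open>d * d \<le> m * n \<le> y\<close>. It gives the sums over
  common divisors one range for all pairs, so that they can be interchanged with the sum over
  pairs.\<close>

lemma common_divisor_le_sqrt:
  assumes "(m, n) \<in> pairs_le y" "d dvd m" "d dvd n"
  shows "d \<in> {1..nat \<lfloor>sqrt y\<rfloor>}"
proof -
  have mn: "0 < m" "0 < n" "real (m * n) \<le> y"
    using assms(1) by (auto simp: pairs_le_def)
  have "d \<le> m" "d \<le> n"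
    using assms(2,3) mn by (auto dest: dvd_imp_le)
  then have "d * d \<le> m * n"
    by (rule mult_le_mono)
  then have "real (d * d) \<le> y"
    using mn(3) by linarith
  moreover have "y \<ge> 0"
    using mn(3) of_nat_0_le_iff[of "m * n"] by linarith
  ultimately have "d \<le> nat \<lfloor>sqrt y\<rfloor>"
    by (simp add: le_nat_floor_sqrt_iff power2_eq_square)
  then show ?thesis
    using assms(2) mn(1) by (cases "d = 0") auto
qed

text \<open>The indicator of coprimality is the sum of \<open>moebius d\<close> over the common
  divisors \<open>d\<close>. After the sums are interchanged, pairs with both entries divisible by
  \<open>d\<close> are scaled down by \<open>d\<close>.\<close>

lemma card_coprime_pairs_le:
  "int (card (coprime_pairs_le y)) =
     (\<Sum>d = 1..nat \<lfloor>sqrt y\<rfloor>. moebius d * int (card (pairs_le (y / real d ^ 2))))"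
proof -
  define I where "I = {1..nat \<lfloor>sqrt y\<rfloor>}"
  have "int (card (coprime_pairs_le y)) = (\<Sum>(m, n)\<in>pairs_le y. if coprime m n then 1 else 0)"
    using finite_pairs_le[of y]
    by (simp add: coprime_pairs_le_def case_prod_unfold sum.If_cases Int_def)
  also have "\<dots> = (\<Sum>(m, n)\<in>pairs_le y. \<Sum>d\<in>I. if d dvd m \<and> d dvd n then moebius d else 0)"
  proof (intro sum.cong refl, clarify)
    fix m n assume mn: "(m, n) \<in> pairs_le y"
    then have pos: "gcd m n > 0"
      by (auto simp: pairs_le_def)
    have "(\<Sum>d\<in>I. if d dvd m \<and> d dvd n then moebius d else 0) =
        (\<Sum>d | d dvd gcd m n. moebius d)"
      using common_divisor_le_sqrt[OF mn] unfolding I_def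
      by (intro sum.mono_neutral_cong_right[symmetric] sum.mono_neutral_cong_right) auto
    then show "(if coprime m n then 1 else 0) =
        (\<Sum>d\<in>I. if d dvd m \<and> d dvd n then moebius d else 0)"
      using sum_moebius_divisors[OF pos] by (simp add: coprime_iff_gcd_eq_1)
  qed
  also have "\<dots> = (\<Sum>d\<in>I. \<Sum>(m, n)\<in>pairs_le y. if d dvd m \<and> d dvd n then moebius d else 0)"
    unfolding case_prod_unfold by (rule sum.swap)
  also have "\<dots> = (\<Sum>d\<in>I. moebius d * int (card (pairs_le (y / real d ^ 2))))"
  proof (intro sum.cong refl)
    fix d assume "d \<in> I"
    then have d: "d > 0" by (simp add: I_def)
    have "bij_betw (\<lambda>(m, n). (d * m, d * n)) (pairs_le (y / real d ^ 2))
            {(m, n) \<in> pairs_le y. d dvd m \<and> d dvd n}"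
      using d by (intro bij_betw_byWitness[where f' = "\<lambda>(m, n). (m div d, n div d)"])
        (auto simp flip: scale_mem_pairs_le_iff)
    then have "card (pairs_le (y / real d ^ 2)) = card {(m, n) \<in> pairs_le y. d dvd m \<and> d dvd n}"
      by (rule bij_betw_same_card)
    then show "(\<Sum>(m, n)\<in>pairs_le y. if d dvd m \<and> d dvd n then moebius d else 0) =
        moebius d * int (card (pairs_le (y / real d ^ 2)))"
      using finite_pairs_le[of y] by (simp add: case_prod_unfold sum.If_cases Int_def)
  qed
  finally show ?thesis by (simp add: I_def)
qed

text \<open>Pairs are grouped by the exact value \<open>d\<close> of their gcd; dividing by
  \<open>d\<close> leaves a coprime pair with product at most \<open>x / d^2\<close>.\<close>

lemma S_mu_eq_sum_coprime_pairs:
  "S_mu x = (\<Sum>d = 1..nat \<lfloor>sqrt x\<rfloor>. moebius d * int (card (coprime_pairs_le (x / real d ^ 2))))"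
proof -
  define I where "I = {1..nat \<lfloor>sqrt x\<rfloor>}"
  have "S_mu x = (\<Sum>p\<in>pairs_le x. moebius (gcd (fst p) (snd p)))"
    by (simp add: S_mu_def pairs_le_def case_prod_unfold)
  also have "\<dots> = (\<Sum>d\<in>I. \<Sum>p | p \<in> pairs_le x \<and> gcd (fst p) (snd p) = d.
      moebius (gcd (fst p) (snd p)))"
    using finite_pairs_le[of x] common_divisor_le_sqrt[of _ _ x]
    unfolding I_def by (intro sum.group[symmetric]) auto
  also have "\<dots> = (\<Sum>d\<in>I. moebius d * int (card (coprime_pairs_le (x / real d ^ 2))))"
  proof (intro sum.cong refl)
    fix d assume "d \<in> I"
    then have d: "d > 0" by (simp add: I_def)
    have "bij_betw (\<lambda>(m, n). (d * m, d * n)) (coprime_pairs_le (x / real d ^ 2))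
            {p \<in> pairs_le x. gcd (fst p) (snd p) = d}"
      using d by (intro bij_betw_byWitness[where f' = "\<lambda>(m, n). (m div d, n div d)"])
        (auto simp: coprime_pairs_le_def gcd_mult_distrib_nat[symmetric] div_gcd_coprime
          simp flip: scale_mem_pairs_le_iff)
    then have "card (coprime_pairs_le (x / real d ^ 2)) =
        card {p \<in> pairs_le x. gcd (fst p) (snd p) = d}"
      by (rule bij_betw_same_card)
    then show "(\<Sum>p | p \<in> pairs_le x \<and> gcd (fst p) (snd p) = d. moebius (gcd (fst p) (snd p))) =
        moebius d * int (card (coprime_pairs_le (x / real d ^ 2)))"
      by simp
  qed
  finally show ?thesis by (simp add: I_def)
qed

section \<open>The Dirichlet divisor problem\<close>

text \<open>Dirichlet's hyperbola method: every pair has an entry at most \<open>N\<close>, the sets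
  \<open>A\<close> and \<open>B\<close> are mirror images, and they overlap in a full square of side
  \<open>N\<close>. Adding \<open>N ^ 2\<close> on the left avoids truncated subtraction.\<close>

lemma card_pairs_le:
  assumes "y \<ge> 0"
  defines "N \<equiv> nat \<lfloor>sqrt y\<rfloor>"
  shows "card (pairs_le y) + N ^ 2 = 2 * (\<Sum>m = 1..N. nat \<lfloor>y / real m\<rfloor>)"
proof -
  define A where "A = {(m, n) \<in> pairs_le y. m \<le> N}"
  define B where "B = {(m, n) \<in> pairs_le y. n \<le> N}"
  have N: "n \<le> N \<longleftrightarrow> real n ^ 2 \<le> y" for n
    using le_nat_floor_sqrt_iff[OF assms(1)] by (simp add: N_def)
  have "A = (SIGMA m:{1..N}. {1..nat \<lfloor>y / real m\<rfloor>})"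
    using assms(1) by (auto simp: A_def pairs_le_def le_nat_iff le_floor_iff field_simps)
  then have cardA: "card A = (\<Sum>m = 1..N. nat \<lfloor>y / real m\<rfloor>)"
    by simp
  have "bij_betw prod.swap A B"
    by (intro bij_betw_byWitness[where f' = prod.swap])
      (auto simp: A_def B_def pairs_le_def mult.commute)
  then have cardB: "card B = card A"
    using bij_betw_same_card by fastforce
  \<comment> \<open>The square of the smaller entry is at most \<open>m * n\<close>.\<close>
  have "m \<le> N \<or> n \<le> N" if "(m, n) \<in> pairs_le y" for m n
  proof -
    have "min m n * min m n \<le> m * n"
      by (intro mult_le_mono) auto
    then have "real (min m n * min m n) \<le> real (m * n)"
      by (simp only: of_nat_le_iff)
    then have "real (min m n) ^ 2 \<le> y"
      using that by (auto simp: pairs_le_def power2_eq_square)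
    then show ?thesis
      using N[of "min m n"] by linarith
  qed
  then have Un: "A \<union> B = pairs_le y"
    by (auto simp: A_def B_def)
  have "real (m * n) \<le> y" if "m \<le> N" "n \<le> N" for m n
  proof -
    have "m * n \<le> N * N"
      using that by (rule mult_le_mono)
    then have "real (m * n) \<le> real (N * N)"
      by (simp only: of_nat_le_iff)
    then show ?thesis
      using N[of N] by (simp add: power2_eq_square)
  qed
  then have Int: "A \<inter> B = {1..N} \<times> {1..N}"
    by (auto simp: A_def B_def pairs_le_def)
  have "finite A" "finite B"
    unfolding A_def B_def by (auto intro!: finite_subset[OF _ finite_pairs_le[of y]])
  then show ?thesis
    using card_Un_Int[of A B] cardA cardB Un Int by (simp add: power2_eq_square)
qed

text \<open>The integer part is at least 1 and exceeds \<open>sqrt y - 1\<close>; adding the two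
  bounds suffices. Later this trades \<open>1 / N\<close> for \<open>2 / sqrt y\<close>.\<close>

lemma sqrt_div_2_le_floor_sqrt:
  assumes "y \<ge> 1"
  shows "sqrt y / 2 \<le> real (nat \<lfloor>sqrt y\<rfloor>)"
proof -
  have "sqrt y \<ge> 1" using assms by simp
  then have "\<lfloor>sqrt y\<rfloor> \<ge> 1" by simp
  then have "real (nat \<lfloor>sqrt y\<rfloor>) \<ge> 1" "real (nat \<lfloor>sqrt y\<rfloor>) > sqrt y - 1"
    by linarith+
  then show ?thesis by linarith
qed

text \<open>The comparison passes through \<open>ln (N + 1)\<close>: it exceeds
  \<open>ln (sqrt y)\<close> by at most \<open>1 / N\<close>, while
  \<open>harm N - ln (N + 1)\<close> falls short of the constant by at most \<open>1 / N\<close>.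
  The two errors have opposite signs, so they do not add up.\<close>

lemma harm_floor_sqrt_bound:
  assumes "y \<ge> 1"
  defines "N \<equiv> nat \<lfloor>sqrt y\<rfloor>"
  shows "\<bar>harm N - ln y / 2 - euler_mascheroni\<bar> \<le> 1 / real N"
proof -
  define s where "s = sqrt y"
  have s: "s \<ge> 1" using assms(1) by (simp add: s_def)
  have N: "N \<ge> 1" "real N \<le> s" "s < real N + 1"
    using s unfolding N_def s_def by linarith+
  have ln_s: "ln y / 2 = ln s"
    using assms(1) by (simp add: s_def ln_sqrt)
  have "ln s \<le> ln (real N + 1)"
    using s N by simp
  moreover have "ln (real N + 1) \<le> ln s + 1 / real N"
  proof -
    have "ln (real N + 1) \<le> ln (s * (1 + 1 / s))"
      using s N by (intro ln_mono) (auto simp: distrib_left)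
    also have "\<dots> = ln s + ln (1 + 1 / s)"
      using s by (intro ln_mult_pos) (auto intro: add_pos_pos)
    also have "ln (1 + 1 / s) \<le> 1 / s"
      using s by (intro ln_add_one_self_le_self) auto
    also have "1 / s \<le> 1 / real N"
      using s N by (intro divide_left_mono) auto
    finally show ?thesis by simp
  qed
  moreover have "harm N - ln (real N + 1) \<le> euler_mascheroni"
    "euler_mascheroni \<le> harm N - ln (real N + 1) + 1 / real N"
  proof -
    have "0 \<le> inverse (real (2 * (N + 1)))" "inverse (real (2 * N)) \<le> 1 / real N"
      using N by (auto simp: field_simps)
    then show "harm N - ln (real N + 1) \<le> euler_mascheroni"
        "euler_mascheroni \<le> harm N - ln (real N + 1) + 1 / real N"
      using euler_mascheroni_bounds[OF N(1)] unfolding atLeastAtMost_iff of_nat_Suc add.commute[of 1 "real N"]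
      by linarith+
  qed
  ultimately show ?thesis
    unfolding ln_s by linarith
qed

text \<open>In units of \<open>sqrt y\<close>, removing the floors costs 1 and replacing
  \<open>harm N\<close> costs 2, both doubled by the hyperbola formula; replacing
  \<open>N ^ 2\<close> by \<open>y\<close> costs 2. This gives the constant 8.\<close>

lemma dirichlet_divisor_asymptotics:
  assumes "y \<ge> 1"
  shows "\<bar>real (card (pairs_le y)) - y * (ln y + (2 * euler_mascheroni - 1))\<bar> \<le> 8 * sqrt y"
proof -
  define N where "N = nat \<lfloor>sqrt y\<rfloor>"
  have s: "sqrt y \<ge> 1" using assms by simp
  then have "\<lfloor>sqrt y\<rfloor> \<ge> 1" by simp
  then have N: "real N \<ge> 1" "real N \<le> sqrt y" "sqrt y < real N + 1"
    using s unfolding N_def by linarith+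
  have half: "sqrt y / 2 \<le> real N"
    using sqrt_div_2_le_floor_sqrt[OF assms] by (simp add: N_def)
  have yy: "y = sqrt y * sqrt y" using assms by simp
  have "card (pairs_le y) + N ^ 2 = 2 * (\<Sum>m = 1..N. nat \<lfloor>y / real m\<rfloor>)"
    using card_pairs_le[of y] assms by (simp add: N_def)
  then have "real (card (pairs_le y) + N ^ 2) = real (2 * (\<Sum>m = 1..N. nat \<lfloor>y / real m\<rfloor>))"
    by (rule arg_cong)
  then have card: "real (card (pairs_le y)) = 2 * (\<Sum>m = 1..N. real (nat \<lfloor>y / real m\<rfloor>)) - real N ^ 2"
    by simp
  have "\<bar>(\<Sum>m = 1..N. real (nat \<lfloor>y / real m\<rfloor>)) - y * harm N\<bar> =
      \<bar>\<Sum>m = 1..N. (real (nat \<lfloor>y / real m\<rfloor>) - y / real m)\<bar>"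
    by (simp add: harm_def sum_subtractf sum_distrib_left divide_inverse)
  also have "\<dots> \<le> (\<Sum>m = 1..N. 1)"
  proof (rule order.trans[OF sum_abs sum_mono])
    fix m assume "m \<in> {1..N}"
    have "y / real m \<ge> 0" using assms by simp
    then show "\<bar>real (nat \<lfloor>y / real m\<rfloor>) - y / real m\<bar> \<le> 1" by linarith
  qed
  finally have floor_err: "\<bar>(\<Sum>m = 1..N. real (nat \<lfloor>y / real m\<rfloor>)) - y * harm N\<bar> \<le> sqrt y"
    using N by simp
  have "y * harm N - y * (ln y / 2 + euler_mascheroni) =
      y * (harm N - ln y / 2 - euler_mascheroni)"
    by (simp add: algebra_simps)
  then have "\<bar>y * harm N - y * (ln y / 2 + euler_mascheroni)\<bar> =
      y * \<bar>harm N - ln y / 2 - euler_mascheroni\<bar>"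
    using assms by (simp add: abs_mult)
  also have "\<dots> \<le> y * (1 / real N)"
    using harm_floor_sqrt_bound[OF assms] assms by (intro mult_left_mono) (auto simp: N_def)
  also have "\<dots> \<le> 2 * sqrt y"
  proof -
    have "sqrt y * sqrt y \<le> sqrt y * (2 * real N)"
      using half s by (intro mult_left_mono) auto
    then show ?thesis using N yy by (simp add: field_simps)
  qed
  finally have harm_err: "\<bar>y * harm N - y * (ln y / 2 + euler_mascheroni)\<bar> \<le> 2 * sqrt y" .
  have "real N ^ 2 \<le> y"
    using power_mono[OF N(2), of 2] assms by simp
  moreover have "(sqrt y - 1) ^ 2 \<le> real N ^ 2"
    using N s by (intro power_mono) auto
  then have "y - 2 * sqrt y \<le> real N ^ 2"
    using assms by (simp add: power2_diff)
  ultimately have "\<bar>real N ^ 2 - y\<bar> \<le> 2 * sqrt y" using s by linarith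
  then show ?thesis
    using floor_err harm_err unfolding card by (simp add: algebra_simps abs_le_iff)
qed

section \<open>Dirichlet series at 2\<close>

text \<open>
  The exact primitive of \<open>- (1 + ln t) / t\<^sup>2\<close> is \<open>(2 + ln t) / t\<close>; the larger constant 3 makes the
  elementary bound \<open>ln (1 + 1/m) \<le> 1/m\<close> sufficient.
\<close>

lemma tail_telescope_bound:
  assumes "m \<ge> 1"
  shows "(1 + ln (real (Suc m))) / real (Suc m) ^ 2
           \<le> (3 + ln (real m)) / real m - (3 + ln (real (Suc m))) / real (Suc m)"
proof -
  define u where "u = ln (real (Suc m))"
  have m: "real m \<ge> 1" using assms by simp
  have u: "u \<ge> 0" by (simp add: u_def)
  have "u = ln (real m * (1 + 1 / real m))"
    using m by (simp add: u_def distrib_left add.commute)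
  also have "\<dots> = ln (real m) + ln (1 + 1 / real m)"
    using m by (intro ln_mult_pos) (auto intro: add_pos_pos)
  also have "ln (1 + 1 / real m) \<le> 1 / real m"
    using m by (intro ln_add_one_self_le_self) auto
  finally have "u - 1 / real m \<le> ln (real m)" by simp
  then have "(3 + (u - 1 / real m)) / real m \<le> (3 + ln (real m)) / real m"
    using m by (intro divide_right_mono) auto
  moreover have "(1 + u) / real (Suc m) ^ 2 \<le> (3 + (u - 1 / real m)) / real m - (3 + u) / real (Suc m)"
  proof -
    \<comment> \<open>With 2 in place of 3 the numerator would be \<open>m * u - 1\<close>, which is
      negative at \<open>m = 1\<close>.\<close>
    have "(3 + (u - 1 / real m)) / real m - (3 + u) / real (Suc m) - (1 + u) / real (Suc m) ^ 2
        = (real m ^ 2 + real m * (1 + u) - 1) / (real m ^ 2 * real (Suc m) ^ 2)"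
      using m by (simp add: divide_simps) algebra
    also have "\<dots> \<ge> 0"
      using m u one_le_power[OF m, of 2]
      by (intro divide_nonneg_nonneg) (auto intro: add_increasing2)
    finally show ?thesis by simp
  qed
  ultimately show ?thesis unfolding u_def by linarith
qed

text \<open>The telescoping bound is summed from \<open>N\<close> on; since \<open>g\<close> tends
  to 0, only its value at \<open>N\<close> remains.\<close>

lemma log_over_square_tail:
  assumes "N \<ge> 1"
  shows "summable (\<lambda>n. (1 + ln (real (n + Suc N))) / real (n + Suc N) ^ 2)"
    and "(\<Sum>n. (1 + ln (real (n + Suc N))) / real (n + Suc N) ^ 2) \<le> (3 + ln (real N)) / real N"
proof -
  define g where "g = (\<lambda>n. (3 + ln (real n)) / real n)"
  have "g \<longlonglongrightarrow> 0"
    unfolding g_def by real_asymp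
  then have "(\<lambda>n. g (n + N)) \<longlonglongrightarrow> 0"
    by (rule LIMSEQ_ignore_initial_segment)
  then have g: "(\<lambda>n. g (n + N) - g (Suc n + N)) sums (g (0 + N) - 0)"
    by (rule telescope_sums')
  have le: "(1 + ln (real (n + Suc N))) / real (n + Suc N) ^ 2 \<le> g (n + N) - g (Suc n + N)" for n
    using tail_telescope_bound[of "n + N"] assms by (simp add: g_def)
  have nonneg: "0 \<le> (1 + ln (real (n + Suc N))) / real (n + Suc N) ^ 2" for n
    by (intro divide_nonneg_nonneg add_nonneg_nonneg ln_ge_zero) auto
  show sm: "summable (\<lambda>n. (1 + ln (real (n + Suc N))) / real (n + Suc N) ^ 2)"
    using nonneg le by (intro summable_comparison_test'[OF sums_summable[OF g]]) (simp add: abs_of_nonneg)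
  show "(\<Sum>n. (1 + ln (real (n + Suc N))) / real (n + Suc N) ^ 2) \<le> (3 + ln (real N)) / real N"
    using suminf_le[OF le sm sums_summable[OF g]] sums_unique[OF g] by (simp add: g_def)
qed

section \<open>The four constants as absolutely convergent series\<close>

lemma summable_log_over_square: "summable (\<lambda>n. (1 + ln (real n)) / real n ^ 2)"
  using log_over_square_tail(1)[of 1] summable_iff_shift[of _ "Suc 1"] by blast

text \<open>A single majorant serves all four series below.\<close>

lemma summable_le_log_over_square:
  fixes f :: "nat \<Rightarrow> real"
  assumes "\<And>n. n \<ge> 1 \<Longrightarrow> \<bar>f n\<bar> \<le> (1 + ln (real n)) / real n ^ 2"
  shows "summable (\<lambda>n. \<bar>f n\<bar>)"
  using assms by (intro summable_comparison_test'[OF summable_log_over_square, of 1]) auto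

text \<open>In this and the next three series the term at 0 vanishes because division by 0 yields 0.
  In order, the values are 1/\<zeta>(2), \<zeta>'(2)/\<zeta>(2)^2, \<zeta>(2) and
  -\<zeta>'(2).\<close>

definition moebius_sum :: real where
  "moebius_sum = (\<Sum>n. real_of_int (moebius n) / real n ^ 2)"

definition moebius_log_sum :: real where
  "moebius_log_sum = (\<Sum>n. real_of_int (moebius n) * ln (real n) / real n ^ 2)"

definition zeta2 :: real where
  "zeta2 = (\<Sum>n. 1 / real n ^ 2)"

definition zeta2_log :: real where
  "zeta2_log = (\<Sum>n. ln (real n) / real n ^ 2)"

lemma abs_moebius_real_le: "\<bar>real_of_int (moebius n)\<bar> \<le> 1"
  using abs_moebius_le[of n] by linarith

lemma abs_summable_moebius: "summable (\<lambda>n. \<bar>real_of_int (moebius n) / real n ^ 2\<bar>)"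
proof (rule summable_le_log_over_square)
  fix n :: nat assume "n \<ge> 1"
  then have "\<bar>real_of_int (moebius n)\<bar> \<le> 1 + ln (real n)"
    using abs_moebius_real_le[of n] by (simp add: add_increasing2)
  then show "\<bar>real_of_int (moebius n) / real n ^ 2\<bar> \<le> (1 + ln (real n)) / real n ^ 2"
    by (simp add: abs_divide divide_right_mono)
qed

lemma abs_summable_moebius_log:
  "summable (\<lambda>n. \<bar>real_of_int (moebius n) * ln (real n) / real n ^ 2\<bar>)"
proof (rule summable_le_log_over_square)
  fix n :: nat assume "n \<ge> 1"
  then have "\<bar>real_of_int (moebius n)\<bar> * ln (real n) \<le> 1 * ln (real n)"
    using abs_moebius_real_le[of n] by (intro mult_right_mono) auto
  then have "\<bar>real_of_int (moebius n) * ln (real n)\<bar> \<le> 1 + ln (real n)"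
    using \<open>n \<ge> 1\<close> by (simp add: abs_mult)
  then show "\<bar>real_of_int (moebius n) * ln (real n) / real n ^ 2\<bar> \<le> (1 + ln (real n)) / real n ^ 2"
    by (simp add: abs_divide divide_right_mono)
qed

lemma abs_summable_zeta2: "summable (\<lambda>n. \<bar>1 / real n ^ 2\<bar>)"
  by (rule summable_le_log_over_square) (simp add: divide_right_mono)

lemma abs_summable_zeta2_log: "summable (\<lambda>n. \<bar>ln (real n) / real n ^ 2\<bar>)"
  by (rule summable_le_log_over_square) (simp add: divide_right_mono)

lemma moebius_sums: "(\<lambda>n. real_of_int (moebius n) / real n ^ 2) sums moebius_sum"
  unfolding moebius_sum_def
  by (intro summable_sums summable_rabs_cancel[OF abs_summable_moebius])

lemma moebius_log_sums:
  "(\<lambda>n. real_of_int (moebius n) * ln (real n) / real n ^ 2) sums moebius_log_sum"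
  unfolding moebius_log_sum_def
  by (intro summable_sums summable_rabs_cancel[OF abs_summable_moebius_log])

lemma zeta2_sums: "(\<lambda>n. 1 / real n ^ 2) sums zeta2"
  unfolding zeta2_def
  by (intro summable_sums summable_rabs_cancel[OF abs_summable_zeta2])

lemma zeta2_log_sums: "(\<lambda>n. ln (real n) / real n ^ 2) sums zeta2_log"
  unfolding zeta2_log_def
  by (intro summable_sums summable_rabs_cancel[OF abs_summable_zeta2_log])

text \<open>Absolute convergence makes the double series unconditionally summable, so it may be
  regrouped by the product \<open>n = d * e\<close>. Vanishing at 0 allows restriction to positive
  indices, where this regrouping is a bijection.\<close>

lemma dirichlet_product_has_sum:
  fixes f g :: "nat \<Rightarrow> real"
  assumes f: "summable (\<lambda>n. \<bar>f n\<bar>)" "f sums a" "f 0 = 0"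
    and g: "summable (\<lambda>n. \<bar>g n\<bar>)" "g sums b" "g 0 = 0"
  shows "((\<lambda>n. \<Sum>d | d dvd n. f d * g (n div d)) has_sum (a * b)) {0<..}"
proof -
  have pos: "(u has_sum c) {0<..}" "(\<lambda>n. \<bar>u n\<bar>) summable_on {0<..}"
    if "summable (\<lambda>n. \<bar>u n\<bar>)" "u sums c" "u 0 = 0" for u :: "nat \<Rightarrow> real" and c
  proof -
    have "(u has_sum c) UNIV"
      using that by (intro norm_summable_imp_has_sum) auto
    then show "(u has_sum c) {0<..}"
      using that by (subst has_sum_cong_neutral[where g = u and T = UNIV]) auto
    have "(\<lambda>n. \<bar>u n\<bar>) summable_on UNIV"
      using that(1) by (intro norm_summable_imp_summable_on) auto
    then show "(\<lambda>n. \<bar>u n\<bar>) summable_on {0<..}"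
      by (rule summable_on_subset) auto
  qed
  have "(\<lambda>(d, e). \<bar>f d\<bar> * \<bar>g e\<bar>) summable_on ({0<..} \<times> {0<..})"
    using pos(2)[OF f] pos(2)[OF g]
    by (intro summable_on_SigmaI[where g = "\<lambda>d. \<bar>f d\<bar> * infsum (\<lambda>e. \<bar>g e\<bar>) {0<..}"])
      (auto intro: has_sum_cmult_right has_sum_infsum summable_on_cmult_left)
  then have "(\<lambda>(d, e). f d * g e) summable_on ({0<..} \<times> {0<..})"
    by - (rule abs_summable_summable, simp add: abs_mult case_prod_unfold)
  then have "((\<lambda>(d, e). f d * g e) has_sum (a * b)) ({0<..} \<times> {0<..})"
    using pos(1)[OF f] pos(1)[OF g] by (intro has_sum_SigmaI[where g = "\<lambda>d. f d * b"])
      (auto intro: has_sum_cmult_left has_sum_cmult_right)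
  also have "?this \<longleftrightarrow> ((\<lambda>(n, d). f d * g (n div d)) has_sum (a * b)) (SIGMA n:{0<..}. {d. d dvd n})"
    by (rule has_sum_reindex_bij_witness[where i = "\<lambda>(n, d). (d, n div d)" and j = "\<lambda>(d, e). (d * e, d)"])
      (auto elim!: dvdE)
  finally show ?thesis
    by (rule has_sum_SigmaD) (auto intro!: has_sum_finiteI)
qed

text \<open>The coefficient at \<open>n\<close> of the product series is the divisor sum of
  \<open>moebius\<close> over \<open>n^2\<close>, which survives only at
  \<open>n = 1\<close>.\<close>

lemma moebius_sum_mult_zeta2: "moebius_sum * zeta2 = 1"
proof -
  have "((\<lambda>n. \<Sum>d | d dvd n. real_of_int (moebius d) / real d ^ 2 * (1 / real (n div d) ^ 2))
      has_sum (moebius_sum * zeta2)) {0<..}"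
    by (intro dirichlet_product_has_sum abs_summable_moebius abs_summable_zeta2
        moebius_sums zeta2_sums) auto
  moreover have "((\<lambda>n. \<Sum>d | d dvd n. real_of_int (moebius d) / real d ^ 2 * (1 / real (n div d) ^ 2))
      has_sum 1) {0<..}"
  proof (rule has_sum_finite_neutralI[where B = "{1}"])
    fix n :: nat assume n: "n \<in> {0<..} - {1}"
    have "(\<Sum>d | d dvd n. real_of_int (moebius d) / real d ^ 2 * (1 / real (n div d) ^ 2)) =
        (\<Sum>d | d dvd n. real_of_int (moebius d)) / real n ^ 2"
      unfolding sum_divide_distrib
      by (intro sum.cong refl) (auto elim!: dvdE simp: power_mult_distrib)
    also have "(\<Sum>d | d dvd n. real_of_int (moebius d)) = 0"
      using sum_moebius_divisors[of n] n by (simp flip: of_int_sum)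
    finally show "(\<Sum>d | d dvd n. real_of_int (moebius d) / real d ^ 2 * (1 / real (n div d) ^ 2)) = 0"
      by simp
  qed auto
  ultimately show ?thesis
    by (rule has_sum_unique)
qed

text \<open>This is the product rule for the preceding identity. Since
  \<open>ln d + ln (n / d) = ln n\<close>, each coefficient is \<open>ln n / n^2\<close> times the
  divisor sum of \<open>moebius\<close>: the sum vanishes for \<open>n > 1\<close>, the logarithm at
  \<open>n = 1\<close>.\<close>

lemma moebius_log_sum_mult_zeta2:
  "moebius_log_sum * zeta2 + moebius_sum * zeta2_log = 0"
proof -
  define s where "s = (\<lambda>n. (\<Sum>d | d dvd n. real_of_int (moebius d) * ln (real d) / real d ^ 2
          * (1 / real (n div d) ^ 2))
      + (\<Sum>d | d dvd n. real_of_int (moebius d) / real d ^ 2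
          * (ln (real (n div d)) / real (n div d) ^ 2)))"
  have "(s has_sum (moebius_log_sum * zeta2 + moebius_sum * zeta2_log)) {0<..}"
    unfolding s_def
    by (intro has_sum_add dirichlet_product_has_sum abs_summable_moebius abs_summable_zeta2
        abs_summable_moebius_log abs_summable_zeta2_log moebius_log_sums zeta2_log_sums
        moebius_sums zeta2_sums) auto
  moreover have "(s has_sum 0) {0<..}"
  proof (rule has_sum_0)
    fix n :: nat assume n: "n \<in> {0<..}"
    have "s n = (\<Sum>d | d dvd n. real_of_int (moebius d) * (ln (real n) / real n ^ 2))"
      unfolding s_def sum.distrib[symmetric]
      using n by (intro sum.cong refl)
        (auto elim!: dvdE simp: power_mult_distrib ln_mult field_simps)
    also have "\<dots> = (\<Sum>d | d dvd n. real_of_int (moebius d)) * (ln (real n) / real n ^ 2)"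
      by (rule sum_distrib_right[symmetric])
    also have "\<dots> = 0"
      using sum_moebius_divisors[of n] n by (cases "n = 1") (simp_all flip: of_int_sum)
    finally show "s n = 0" .
  qed
  ultimately show ?thesis
    by (rule has_sum_unique)
qed

section \<open>The values of \<zeta> and \<zeta>' at 2\<close>

lemma zeta_2_eq: "zeta 2 = of_real zeta2"
proof -
  have "(\<lambda>n. 1 / real (Suc n) ^ 2) sums zeta2"
    using zeta2_sums by (subst sums_Suc_iff) simp
  then have "(\<lambda>n. complex_of_real (1 / real (Suc n) ^ 2)) sums of_real zeta2"
    by (rule sums_of_real)
  then have "(\<lambda>n. 1 / of_nat (Suc n) powr (2 :: complex)) sums of_real zeta2"
    by (simp del: of_nat_Suc)
  then show ?thesis
    using zeta_sums[of 2] sums_unique2 by auto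
qed

lemma deriv_zeta_2_eq: "deriv zeta 2 = - of_real zeta2_log"
proof -
  \<comment> \<open>Any abscissa strictly between 1 and 2 would do: above 1 for a summable majorant,
    below 2 so that 2 is an interior point.\<close>
  define S where "S = {s. Re s > 3 / 2}"
  define f where "f = (\<lambda>n s. 1 / of_nat (Suc n) powr (s :: complex))"
  define f' where "f' = (\<lambda>n s. - (Ln (of_nat (Suc n)) / of_nat (Suc n) powr (s :: complex)))"
  have S: "open S" "2 \<in> S"
    unfolding S_def by (simp_all only: open_halfspace_Re_gt mem_Collect_eq) simp
  have "summable (\<lambda>n. real n powr (- (3 / 2)))"
    by (simp add: summable_real_powr_iff)
  then have sm: "summable (\<lambda>n. real (Suc n) powr (- (3 / 2)))"
    by (subst summable_Suc_iff)
  have deriv: "(f n has_field_derivative f' n s) (at s)" for n s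
  proof -
    have "of_nat (Suc n) \<noteq> (0 :: complex)" by (simp del: of_nat_Suc)
    then show ?thesis
      unfolding f_def f'_def by (auto intro!: derivative_eq_intros simp: field_simps simp del: of_nat_Suc)
  qed
  have bound: "norm (f n s) \<le> real (Suc n) powr (- (3 / 2))" if "s \<in> S" for n s
  proof -
    have "norm (of_nat (Suc n) powr s) = real (Suc n) powr Re s"
      using norm_powr_real_powr[of "of_nat (Suc n)" s] by (simp del: of_nat_Suc)
    then have "norm (f n s) = real (Suc n) powr (- Re s)"
      by (simp only: f_def norm_divide norm_one powr_minus_divide)
    also have "\<dots> \<le> real (Suc n) powr (- (3 / 2))"
      using that by (intro powr_mono) (auto simp: S_def)
    finally show ?thesis .
  qed
  \<comment> \<open>For holomorphic terms, a summable majorant of the terms themselves already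
    justifies termwise differentiation.\<close>
  obtain g g' where g: "\<forall>s\<in>S. ((\<lambda>n. f n s) sums g s) \<and> ((\<lambda>n. f' n s) sums g' s)
      \<and> (g has_field_derivative g' s) (at s)"
    by (rule series_and_derivative_comparison[OF S(1) sm deriv]) (use bound in \<open>auto intro!: always_eventually\<close>)
  have "zeta s = g s" if "s \<in> S" for s
    using g that zeta_sums[of s] sums_unique2[of "\<lambda>n. f n s"] by (auto simp: S_def f_def)
  then have "(zeta has_field_derivative g' 2) (at 2)"
    using g S has_field_derivative_transform_within_open[of g "g' 2" 2 S zeta] by auto
  then have deriv_eq: "deriv zeta 2 = g' 2"
    by (rule DERIV_imp_deriv)
  have "(\<lambda>n. ln (real (Suc n)) / real (Suc n) ^ 2) sums zeta2_log"
    using zeta2_log_sums by (subst sums_Suc_iff) simp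
  then have "(\<lambda>n. - complex_of_real (ln (real (Suc n)) / real (Suc n) ^ 2)) sums - of_real zeta2_log"
    by (intro sums_minus sums_of_real)
  moreover have "- complex_of_real (ln (real (Suc n)) / real (Suc n) ^ 2) = f' n 2" for n
    using Ln_of_nat[of "Suc n"] by (simp add: f'_def del: of_nat_Suc)
  ultimately have "(\<lambda>n. f' n 2) sums - of_real zeta2_log"
    by simp
  moreover have "(\<lambda>n. f' n 2) sums g' 2"
    using g S(2) by blast
  ultimately show ?thesis
    unfolding deriv_eq by (rule sums_unique2[symmetric])
qed

section \<open>The Moebius transform of an asymptotic formula\<close>

text \<open>The formula for \<open>F\<close> is inserted into each summand. Its errors add up to a
  harmonic sum, which costs one more logarithm; completing the main terms to infinite series costs a
  tail beyond \<open>sqrt y\<close>. The term with \<open>moebius_log_sum\<close> comes from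
  \<open>ln (y / n^2) = ln y - 2 * ln n\<close>. General \<open>A\<close>, \<open>B\<close> and
  \<open>k\<close> permit iteration.\<close>

lemma moebius_transform_asymptotics:
  fixes F :: "real \<Rightarrow> real"
  assumes F: "\<And>y. y \<ge> 1 \<Longrightarrow> \<bar>F y - y * (A * ln y + B)\<bar> \<le> C * (sqrt y * (1 + ln y) ^ k)"
  defines "G \<equiv> (\<lambda>y. \<Sum>n = 1..nat \<lfloor>sqrt y\<rfloor>. real_of_int (moebius n) * F (y / real n ^ 2))"
  shows "\<exists>C'. \<forall>y\<ge>1. \<bar>G y - y * (A * moebius_sum * ln y
           + (B * moebius_sum - 2 * A * moebius_log_sum))\<bar> \<le> C' * (sqrt y * (1 + ln y) ^ Suc k)"
proof (intro exI allI impI)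
  define K where "K = 2 * \<bar>A\<bar> + \<bar>B\<bar>"
  fix y :: real assume y: "y \<ge> 1"
  define N where "N = nat \<lfloor>sqrt y\<rfloor>"
  define l where "l = 1 + ln y"
  \<comment> \<open>\<open>h n\<close> is the main term of the summand at \<open>n\<close>, kept
    also for \<open>n > N\<close>; \<open>T\<close> is its sum over all \<open>n\<close>.\<close>
  define h where "h = (\<lambda>n. real_of_int (moebius n) * (y / real n ^ 2 * (A * ln (y / real n ^ 2) + B)))"
  define T where "T = y * (A * moebius_sum * ln y + (B * moebius_sum - 2 * A * moebius_log_sum))"
  have C: "C \<ge> 0"
    using F[of 1] by simp
  have K: "K \<ge> 0" by (simp add: K_def)
  have l: "l \<ge> 1" using y by (simp add: l_def)
  have s: "sqrt y \<ge> 1" using y by simp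
  then have "\<lfloor>sqrt y\<rfloor> \<ge> 1" by simp
  then have N: "N \<ge> 1" unfolding N_def by linarith
  have N_iff: "n \<le> N \<longleftrightarrow> real n ^ 2 \<le> y" for n
    using le_nat_floor_sqrt_iff[of y n] y by (simp add: N_def)
  have half: "sqrt y / 2 \<le> real N"
    using sqrt_div_2_le_floor_sqrt[OF y] by (simp add: N_def)
  have ln_div: "ln (y / real n ^ 2) = ln y - 2 * ln (real n)" if "n \<ge> 1" for n
    using that y by (simp add: ln_div ln_realpow)
  have "1 * real N \<le> real N * real N"
    using N by (intro mult_right_mono) auto
  then have "real N \<le> y"
    using N_iff[of N] by (simp add: power2_eq_square)
  then have lnN: "ln (real N) \<le> ln y"
    using N y by (intro ln_mono) auto

  have "(\<lambda>n. y * (A * ln y + B) * (real_of_int (moebius n) / real n ^ 2)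
      - 2 * A * y * (real_of_int (moebius n) * ln (real n) / real n ^ 2))
      sums (y * (A * ln y + B) * moebius_sum - 2 * A * y * moebius_log_sum)"
    by (intro sums_diff sums_mult moebius_sums moebius_log_sums)
  moreover have "h n = y * (A * ln y + B) * (real_of_int (moebius n) / real n ^ 2)
      - 2 * A * y * (real_of_int (moebius n) * ln (real n) / real n ^ 2)" for n
    by (cases "n = 0") (simp_all add: h_def ln_div field_simps)
  moreover have "T = y * (A * ln y + B) * moebius_sum - 2 * A * y * moebius_log_sum"
    by (simp add: T_def algebra_simps)
  ultimately have h_sums: "h sums T"
    by presburger
  then have tail: "(\<lambda>n. h (n + Suc N)) sums (T - (\<Sum>n<Suc N. h n))"
    by (rule sums_split_initial_segment)
  have "(\<Sum>n<Suc N. h n) = (\<Sum>n = 1..N. h n)"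
    by (rule sum.mono_neutral_right) (auto simp: h_def)
  with tail have tail: "(\<lambda>n. h (n + Suc N)) sums (T - (\<Sum>n = 1..N. h n))"
    by simp

  \<comment> \<open>For \<open>n > N\<close> the quotient \<open>y / n^2\<close> is below 1, so its
    logarithm is negative, of size \<open>2 * ln n - ln y\<close>, hence at most
    \<open>2 * ln n\<close>.\<close>
  have h_le: "\<bar>h n\<bar> \<le> K * y * ((1 + ln (real n)) / real n ^ 2)" if "n > N" for n
  proof -
    have n: "n \<ge> 1" "y < real n ^ 2"
      using that N_iff[of n] by auto
    have "ln y \<le> ln (real n ^ 2)"
      using n y by (intro ln_mono) auto
    then have "ln y \<le> 2 * ln (real n)"
      using n by (simp add: ln_realpow)
    then have "\<bar>ln (y / real n ^ 2)\<bar> \<le> 2 * ln (real n)"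
      using y ln_div[OF n(1)] ln_ge_zero[OF y] by linarith
    then have "\<bar>A\<bar> * \<bar>ln (y / real n ^ 2)\<bar> \<le> \<bar>A\<bar> * (2 * ln (real n))"
      by (intro mult_left_mono) auto
    then have "\<bar>A * ln (y / real n ^ 2) + B\<bar> \<le> 2 * \<bar>A\<bar> * ln (real n) + \<bar>B\<bar>"
      using abs_triangle_ineq[of "A * ln (y / real n ^ 2)" B] by (simp add: abs_mult)
    also have "\<dots> \<le> K * (1 + ln (real n))"
      using n by (simp add: K_def algebra_simps)
    finally have "\<bar>real_of_int (moebius n)\<bar> * (y / real n ^ 2 * \<bar>A * ln (y / real n ^ 2) + B\<bar>)
        \<le> 1 * (y / real n ^ 2 * (K * (1 + ln (real n))))"
      using y n abs_moebius_real_le by (intro mult_mono) auto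
    then show ?thesis
      using y by (simp add: h_def abs_mult mult_ac)
  qed
  note log_tail = log_over_square_tail[OF N]
  have "\<bar>T - (\<Sum>n = 1..N. h n)\<bar> = norm (\<Sum>n. h (n + Suc N))"
    using sums_unique[OF tail] by simp
  also have "\<dots> \<le> (\<Sum>n. K * y * ((1 + ln (real (n + Suc N))) / real (n + Suc N) ^ 2))"
  proof (intro norm_suminf_le summable_mult log_tail(1))
    show "norm (h (n + Suc N)) \<le> K * y * ((1 + ln (real (n + Suc N))) / real (n + Suc N) ^ 2)" for n
      unfolding real_norm_def by (rule h_le) simp
  qed
  also have "\<dots> = K * y * (\<Sum>n. (1 + ln (real (n + Suc N))) / real (n + Suc N) ^ 2)"
    by (rule suminf_mult[OF log_tail(1)])
  also have "\<dots> \<le> K * y * ((3 + ln (real N)) / real N)"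
    using K y by (intro mult_left_mono log_tail(2)) auto
  \<comment> \<open>The bound \<open>N \<ge> sqrt y / 2\<close> turns \<open>y / N\<close> into
    \<open>2 * sqrt y\<close>, whence the factor 6 below.\<close>
  also have "\<dots> \<le> K * y * ((3 * l) / (sqrt y / 2))"
  proof (intro mult_left_mono frac_le)
    have "3 + u \<le> 3 * (1 + v)" if "u \<le> v" "v \<ge> 0" for u v :: real
      using that by simp
    then show "3 + ln (real N) \<le> 3 * l"
      unfolding l_def using lnN ln_ge_zero[OF y] by blast
  qed (use K y half l s in auto)
  also have "\<dots> = 6 * K * (sqrt y * l)"
  proof -
    have "K * (r * r) * (3 * l / (r / 2)) = 6 * K * (r * l)" if "r \<ge> 1" for r
      using that by (simp add: field_simps)
    from this[OF s] show ?thesis using y by simp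
  qed
  also have "\<dots> \<le> 6 * K * (sqrt y * l ^ Suc k)"
    using K s l self_le_power[of l "Suc k"] by (intro mult_left_mono) auto
  finally have tail_err: "\<bar>T - (\<Sum>n = 1..N. h n)\<bar> \<le> 6 * K * (sqrt y * l ^ Suc k)" .

  \<comment> \<open>For \<open>n \<le> N\<close> the argument \<open>y / n^2\<close> is at least 1,
    so the hypothesis on \<open>F\<close> applies, and \<open>sqrt (y / n^2) = sqrt y / n\<close>
    produces the harmonic sum.\<close>
  have "\<bar>G y - (\<Sum>n = 1..N. h n)\<bar> = \<bar>\<Sum>n = 1..N. real_of_int (moebius n)
      * (F (y / real n ^ 2) - y / real n ^ 2 * (A * ln (y / real n ^ 2) + B))\<bar>"
    by (simp add: G_def h_def N_def sum_subtractf right_diff_distrib)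
  also have "\<dots> \<le> (\<Sum>n = 1..N. C * (sqrt y * l ^ k) * inverse (real n))"
  proof (rule order.trans[OF sum_abs sum_mono])
    fix n assume "n \<in> {1..N}"
    then have n: "n \<ge> 1" "real n ^ 2 \<le> y"
      using N_iff by auto
    define z where "z = y / real n ^ 2"
    have z: "z \<ge> 1" using n by (simp add: z_def field_simps)
    have "1 + ln z \<le> l"
      using n ln_div[OF n(1)] by (simp add: z_def l_def)
    then have "(1 + ln z) ^ k \<le> l ^ k"
      using z by (intro power_mono) auto
    moreover have "sqrt z = sqrt y * inverse (real n)"
      by (simp add: z_def real_sqrt_divide) (simp add: divide_inverse)
    ultimately have "sqrt z * (1 + ln z) ^ k \<le> sqrt y * inverse (real n) * l ^ k"
      using s n by (auto intro!: mult_left_mono)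
    then have "C * (sqrt z * (1 + ln z) ^ k) \<le> C * (sqrt y * inverse (real n) * l ^ k)"
      using C by (rule mult_left_mono)
    then have "\<bar>F z - z * (A * ln z + B)\<bar> \<le> C * (sqrt y * l ^ k) * inverse (real n)"
      using F[OF z] by (simp add: algebra_simps)
    then have "\<bar>real_of_int (moebius n)\<bar> * \<bar>F z - z * (A * ln z + B)\<bar>
        \<le> 1 * (C * (sqrt y * l ^ k) * inverse (real n))"
      using abs_moebius_real_le by (intro mult_mono) auto
    then show "\<bar>real_of_int (moebius n)
        * (F (y / real n ^ 2) - y / real n ^ 2 * (A * ln (y / real n ^ 2) + B))\<bar>
        \<le> C * (sqrt y * l ^ k) * inverse (real n)"
      by (simp add: z_def abs_mult)
  qed
  also have "\<dots> = C * (sqrt y * l ^ k) * harm N"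
    by (simp add: harm_def sum_distrib_left)
  \<comment> \<open>Since \<open>harm N - ln N\<close> decreases from its value 1 at
    \<open>N = 1\<close>, \<open>harm N \<le> 1 + ln N \<le> l\<close>; this is the additional power
    of \<open>l\<close>.\<close>
  also have "\<dots> \<le> C * (sqrt y * l ^ k) * l"
  proof (rule mult_left_mono)
    show "harm N \<le> l"
      using euler_mascheroni_sequence_decreasing[of 1 N] N lnN by (simp add: l_def harm_def)
  qed (use C s l in auto)
  finally have main_err: "\<bar>G y - (\<Sum>n = 1..N. h n)\<bar> \<le> C * (sqrt y * l ^ Suc k)"
    by (simp add: algebra_simps)
  have "\<bar>G y - T\<bar> \<le> C * (sqrt y * l ^ Suc k) + 6 * K * (sqrt y * l ^ Suc k)"
    using main_err tail_err by linarith
  then show "\<bar>G y - y * (A * moebius_sum * ln y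
      + (B * moebius_sum - 2 * A * moebius_log_sum))\<bar>
      \<le> (C + 6 * (2 * \<bar>A\<bar> + \<bar>B\<bar>)) * (sqrt y * (1 + ln y) ^ Suc k)"
    by (simp only: T_def l_def K_def distrib_right)
qed

section \<open>Two transforms of the divisor problem and the resulting constants\<close>

theorem theorem1:
  shows "\<exists>C::real. \<forall>x::real. x > 5 \<longrightarrow>
    norm (of_int (S_mu x)
          - 1 / (zeta 2)\<^sup>2
            * (of_real (ln x) + 2 * euler_mascheroni - 1 - 4 * (deriv zeta 2 / zeta 2))
            * of_real x)
      \<le> C * (x powr (1/2) * (ln x)\<^sup>2)"
proof -
  define \<gamma> :: real where "\<gamma> = euler_mascheroni"
  define M where "M = moebius_sum"
  define L where "L = moebius_log_sum"
  have "\<bar>real (card (pairs_le y)) - y * (1 * ln y + (2 * \<gamma> - 1))\<bar> \<le> 8 * (sqrt y * (1 + ln y) ^ 0)"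
    if "y \<ge> 1" for y
    using dirichlet_divisor_asymptotics[OF that] by (simp add: \<gamma>_def)
  \<comment> \<open>First transform, with \<open>A = 1\<close>, \<open>B = 2 * \<gamma> - 1\<close>
    and \<open>k = 0\<close>.\<close>
  from moebius_transform_asymptotics[OF this] obtain C1 where C1:
    "\<bar>real (card (coprime_pairs_le y)) - y * (M * ln y + ((2 * \<gamma> - 1) * M - 2 * L))\<bar>
      \<le> C1 * (sqrt y * (1 + ln y) ^ 1)" if "y \<ge> 1" for y
    using arg_cong[OF card_coprime_pairs_le, of real_of_int] by (auto simp: M_def L_def)
  \<comment> \<open>Second transform, with \<open>A = M\<close>,
    \<open>B = (2 * \<gamma> - 1) * M - 2 * L\<close> and \<open>k = 1\<close>.\<close>
  from moebius_transform_asymptotics[OF this] obtain C2 where C2: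
    "\<bar>real_of_int (S_mu x) - x * (M * M * ln x + (((2 * \<gamma> - 1) * M - 2 * L) * M - 2 * M * L))\<bar>
      \<le> C2 * (sqrt x * (1 + ln x) ^ 2)" if "x \<ge> 1" for x
    using arg_cong[OF S_mu_eq_sum_coprime_pairs, of real_of_int]
    by (auto simp: M_def L_def numeral_2_eq_2)
  have C2_nonneg: "C2 \<ge> 0"
    using C2[of 1] by simp
  have Z: "zeta2 \<noteq> 0"
    using moebius_sum_mult_zeta2 by auto
  then have M: "M = 1 / zeta2"
    using moebius_sum_mult_zeta2 by (simp add: M_def field_simps)
  have L: "L = - zeta2_log / zeta2 ^ 2"
  proof -
    have "L * zeta2 + 1 / zeta2 * zeta2_log = 0"
      using moebius_log_sum_mult_zeta2 M by (simp add: M_def L_def)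
    then show ?thesis
      using Z by (simp add: divide_simps power2_eq_square)
  qed
  show ?thesis
  proof (intro exI allI impI)
    fix x :: real assume x: "x > 5"
    \<comment> \<open>As \<open>x\<close> exceeds \<open>exp 1\<close>,
      \<open>1 + ln x \<le> 2 * ln x\<close>; squaring gives the factor 4 in the final
      constant.\<close>
    have "exp 1 \<le> x"
      using x exp_le by linarith
    then have ln_x: "ln x \<ge> 1"
      using x by (simp add: ln_ge_iff)
    \<comment> \<open>Each transform contributes \<open>- 2 * L * M\<close>; after
      \<open>M^2\<close> is factored out, the total becomes \<open>- 4 * L / M\<close>, and
      \<open>L / M = - zeta2_log / zeta2\<close>.\<close>
    have "x * (M * M * ln x + (((2 * \<gamma> - 1) * M - 2 * L) * M - 2 * M * L)) =
        1 / zeta2\<^sup>2 * (ln x + 2 * \<gamma> - 1 - 4 * (- zeta2_log / zeta2)) * x"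
      using Z unfolding M L by (simp add: field_simps power2_eq_square)
    then have "of_int (S_mu x)
          - 1 / (zeta 2)\<^sup>2
            * (of_real (ln x) + 2 * euler_mascheroni - 1 - 4 * (deriv zeta 2 / zeta 2))
            * of_real x =
        complex_of_real (real_of_int (S_mu x)
          - x * (M * M * ln x + (((2 * \<gamma> - 1) * M - 2 * L) * M - 2 * M * L)))"
      by (simp add: zeta_2_eq deriv_zeta_2_eq \<gamma>_def)
    then have "norm (of_int (S_mu x)
          - 1 / (zeta 2)\<^sup>2
            * (of_real (ln x) + 2 * euler_mascheroni - 1 - 4 * (deriv zeta 2 / zeta 2))
            * of_real x) \<le> C2 * (sqrt x * (1 + ln x) ^ 2)"
      using C2[of x] x by (simp only: norm_of_real)
    also have "\<dots> \<le> C2 * (sqrt x * (2 * ln x) ^ 2)"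
      using C2_nonneg ln_x x by (intro mult_left_mono power_mono) auto
    also have "\<dots> = 4 * C2 * (x powr (1/2) * (ln x)\<^sup>2)"
      using x by (simp add: powr_half_sqrt power_mult_distrib)
    finally show "norm (of_int (S_mu x)
          - 1 / (zeta 2)\<^sup>2
            * (of_real (ln x) + 2 * euler_mascheroni - 1 - 4 * (deriv zeta 2 / zeta 2))
            * of_real x) \<le> 4 * C2 * (x powr (1/2) * (ln x)\<^sup>2)" .
  qed
qed

end
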